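(* Let $k\ge 1$ and $\nu>k$ be integers. Then for every $(N,D)\in\Delta(\nu,k,k)$, $$\frac{R^*(N,D)}{R(N,D)} \le \frac{2}{\sum_{h=0}^k \binom{\nu}{h}\binom{\nu-1-h}{k-h}+1}.$$
   Context: An array with $\nu$ columns over $\{0,1\}$ is a finite sequence of rows in $\{0,1\}^\nu$. For integers $k>0$, $d\ge k$, $\nu\ge d$, $\Delta(\nu,d,k)$ is the set of pairs $(N,D)$ of arrays with $\nu$ columns over $\{0,1\}$ such that: $N$ contains at least one occurrence of the all-ones row $(1,\ldots,1)$; each row of $D$ has at most $d$ non-zero coordinates; and for every choice of $k$ columns, extracting these $k$ columns from $N$ and from $D$ yields the same array up to the order of rows (so $N$ and $D$ have the same number of rows). $R^*(N,D)$ denotes the number of occurrences of the all-ones row in $N$ and $R(N,D)$ the number of rows of $D$. *)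

theory Defs
  imports Complex_Main "HOL-Library.Multiset"
begin

definition array01 :: "nat \<Rightarrow> nat list list \<Rightarrow> bool" where
  "array01 \<nu> A \<longleftrightarrow> (\<forall>r\<in>set A. length r = \<nu> \<and> set r \<subseteq> {0, 1})"

definition ones_row :: "nat \<Rightarrow> nat list" where
  "ones_row \<nu> = replicate \<nu> 1"

definition extract_cols :: "nat set \<Rightarrow> nat list list \<Rightarrow> nat list list" where
  "extract_cols J A = map (\<lambda>r. nths r J) A"

text \<open>Columns are indexed from \<open>0\<close>; two arrays are equal up to the order of rows
  iff their multisets of rows coincide. The set is meant for \<open>0 < k \<le> d \<le> \<nu>\<close>.\<close>

definition Delta :: "nat \<Rightarrow> nat \<Rightarrow> nat \<Rightarrow> (nat list list \<times> nat list list) set" where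
  "Delta \<nu> d k = {(N, D). array01 \<nu> N \<and> array01 \<nu> D \<and>
     ones_row \<nu> \<in> set N \<and>
     (\<forall>r\<in>set D. card {j. j < \<nu> \<and> r ! j \<noteq> 0} \<le> d) \<and>
     (\<forall>J. J \<subseteq> {..<\<nu>} \<and> card J = k \<longrightarrow>
        mset (extract_cols J N) = mset (extract_cols J D))}"

definition R_star :: "nat \<Rightarrow> nat list list \<Rightarrow> nat list list \<Rightarrow> nat" where
  "R_star \<nu> N D = count_list N (ones_row \<nu>)"

definition R_rows :: "nat list list \<Rightarrow> nat list list \<Rightarrow> nat" where
  "R_rows N D = length D"

end

theory Submission
  imports Defs
begin

text \<open>The agreement of all \<open>k\<close>-column marginals says that the row weights of \<open>N\<close> and \<open>D\<close> have the
  same sum against every polynomial of degree at most \<open>k\<close>. Apply this to the polynomial \<open>q\<close> of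
  degree \<open>k\<close> with \<open>q s = (-1)^(k-s)\<close> for \<open>s = 0, \<dots>, k\<close>. On \<open>D\<close> all weights are at most \<open>k\<close>, so
  \<open>q \<le> 1\<close> there. For \<open>s > k\<close>, \<open>q s\<close> is the nonnegative sum occurring in the theorem, so
  \<open>q \<ge> -1\<close> on every row of \<open>N\<close>, while the all-ones rows contribute \<open>q \<nu>\<close>. Hence
  \<open>q \<nu> R\<^sup>* - (R - R\<^sup>*) \<le> R\<close>.\<close>

definition weight :: "nat list \<Rightarrow> nat" where
  "weight r = card {j. j < length r \<and> r ! j \<noteq> 0}"

text \<open>The Newton form of the interpolating polynomial.\<close>

definition alt_poly :: "nat \<Rightarrow> nat \<Rightarrow> int" where
  "alt_poly k s = (\<Sum>h\<le>k. (-1) ^ (k + h) * 2 ^ h * int (s choose h))"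

definition binomial_conv :: "nat \<Rightarrow> nat \<Rightarrow> nat" where
  "binomial_conv k s = (\<Sum>h\<le>k. (s choose h) * ((s - 1 - h) choose (k - h)))"

text \<open>Terms with \<open>s < h\<close> vanish, so the truncated sum is the full binomial
  expansion of \<open>(-2 + 1) ^ s\<close>, up to the factor \<open>(-1) ^ k\<close>.\<close>

lemma alt_poly_le:
  assumes "s \<le> k"
  shows "alt_poly k s = (-1) ^ (k + s)"
proof -
  have "alt_poly k s = (-1) ^ k * (\<Sum>h\<le>k. int (s choose h) * (-2) ^ h)"
    unfolding alt_poly_def sum_distrib_left
    by (intro sum.cong refl) (simp add: power_add power_minus[of 2] mult_ac)
  also have "(\<Sum>h\<le>k. int (s choose h) * (-2) ^ h) = (\<Sum>h\<le>s. int (s choose h) * (-2) ^ h)"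
    by (rule sum.mono_neutral_right) (use assms in \<open>auto simp: binomial_eq_0\<close>)
  also have "\<dots> = (-2 + 1) ^ s"
    by (simp only: binomial_ring power_one mult_1_right)
  finally show ?thesis
    by (simp add: power_add)
qed

text \<open>Raising \<open>k\<close> by one flips the sign of every old term, so only the new top
  term survives.\<close>

lemma alt_poly_Suc: "alt_poly (Suc k) s + alt_poly k s = 2 ^ Suc k * int (s choose Suc k)"
  unfolding alt_poly_def by (simp add: sum_negf power_add)

text \<open>Matches the recurrence of \<open>alt_poly\<close>. Pascal's rule merges the two sums;
  trinomial revision then pulls out \<open>s choose Suc k\<close> and leaves a full row sum of
  binomials.\<close>

lemma binomial_conv_Suc:
  assumes "Suc k < s"
  shows "binomial_conv (Suc k) s + binomial_conv k s = 2 ^ Suc k * (s choose Suc k)"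
proof -
  have step: "((s - 1 - h) choose (Suc k - h)) + ((s - 1 - h) choose (k - h))
      = (s - h) choose (Suc k - h)" if "h \<le> k" for h
  proof -
    have "s - h = Suc (s - 1 - h)" "Suc k - h = Suc (k - h)"
      using that assms by auto
    then show ?thesis by simp
  qed
  have "binomial_conv (Suc k) s + binomial_conv k s
      = (\<Sum>h\<le>k. (s choose h) * (((s - 1 - h) choose (Suc k - h)) + ((s - 1 - h) choose (k - h))))
        + (s choose Suc k)"
    unfolding binomial_conv_def by (simp add: sum.distrib distrib_left)
  also have "\<dots> = (\<Sum>h\<le>Suc k. (s choose h) * ((s - h) choose (Suc k - h)))"
    using step by simp
  also have "\<dots> = (\<Sum>h\<le>Suc k. (s choose Suc k) * (Suc k choose h))"
    by (intro sum.cong refl) (use assms in \<open>simp add: choose_mult[symmetric]\<close>)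
  also have "\<dots> = (s choose Suc k) * 2 ^ Suc k"
    by (simp only: sum_distrib_left[symmetric] choose_row_sum)
  finally show ?thesis by (simp add: mult.commute)
qed

text \<open>Both sides satisfy the same recurrence in \<open>k\<close> and equal 1 at
  \<open>k = 0\<close>.\<close>

lemma alt_poly_gt: "k < s \<Longrightarrow> alt_poly k s = int (binomial_conv k s)"
proof (induction k)
  case 0
  then show ?case by (simp add: alt_poly_def binomial_conv_def)
next
  case (Suc k)
  have "int (binomial_conv (Suc k) s + binomial_conv k s) = 2 ^ Suc k * int (s choose Suc k)"
    by (subst binomial_conv_Suc[OF Suc.prems]) simp
  with alt_poly_Suc[of k s] Suc show ?case by simp
qed

lemma alt_poly_ge: "alt_poly k s \<ge> -1"
proof (cases "k < s")
  case False
  then show ?thesis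
    by (cases "even (k + s)") (simp_all add: alt_poly_le)
qed (simp add: alt_poly_gt)

lemma nths_eq_imp_nth_eq:
  assumes "length r = length r'" "nths r J = nths r' J" "j \<in> J" "j < length r"
  shows "r ! j = r' ! j"
  using assms
proof (induction r r' arbitrary: J j rule: list_induct2)
  case (Cons x xs y ys)
  from Cons.prems(1) have "nths xs {j. Suc j \<in> J} = nths ys {j. Suc j \<in> J}"
    by (auto simp: nths_Cons split: if_splits)
  with Cons show ?case
    by (cases j) (auto simp: nths_Cons)
qed simp

text \<open>Counts the \<open>h\<close>-subsets of the support of \<open>r\<close>. The indicator
  form allows summing over rows first, for each fixed column set.\<close>

lemma choose_weight:
  "weight r choose h
    = (\<Sum>J | J \<subseteq> {..<length r} \<and> card J = h. if \<forall>j\<in>J. r ! j \<noteq> 0 then 1 else 0)"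
proof -
  let ?W = "{j. j < length r \<and> r ! j \<noteq> 0}"
  have fin: "finite {J. J \<subseteq> {..<length r} \<and> card J = h}"
    by (rule finite_subset[of _ "Pow {..<length r}"]) auto
  have "weight r choose h = card {J. J \<subseteq> ?W \<and> card J = h}"
    unfolding weight_def by (subst n_subsets) auto
  also have "{J. J \<subseteq> ?W \<and> card J = h}
      = {J. J \<subseteq> {..<length r} \<and> card J = h} \<inter> {J. \<forall>j\<in>J. r ! j \<noteq> 0}"
    by auto
  finally show ?thesis
    using fin by (simp add: sum.If_cases)
qed

context
  fixes \<nu> k :: nat and N D :: "nat list list"
  assumes k_le: "k \<le> \<nu>"
    and rows: "array01 \<nu> N" "array01 \<nu> D"
    and marginals: "\<And>J. J \<subseteq> {..<\<nu>} \<Longrightarrow> card J = k \<Longrightarrow>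
      mset (extract_cols J N) = mset (extract_cols J D)"
begin

lemma length_eq: "length N = length D"
proof -
  have "size (mset (extract_cols {..<k} N)) = size (mset (extract_cols {..<k} D))"
    using marginals[of "{..<k}"] k_le by simp
  then show ?thesis by (simp add: extract_cols_def)
qed

text \<open>Enlarge \<open>J\<close> to a set \<open>K\<close> of exactly \<open>k\<close> columns:
  the indicator depends only on the extraction to \<open>K\<close>, whose multiset is the same for
  \<open>N\<close> and \<open>D\<close>.\<close>

lemma sum_indicator_eq:
  assumes "J \<subseteq> {..<\<nu>}" "card J \<le> k"
  shows "(\<Sum>r\<leftarrow>N. if \<forall>j\<in>J. r ! j \<noteq> 0 then 1 else 0 :: nat)
    = (\<Sum>r\<leftarrow>D. if \<forall>j\<in>J. r ! j \<noteq> 0 then 1 else 0)"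
proof -
  obtain K where K: "J \<subseteq> K" "K \<subseteq> {..<\<nu>}" "card K = k"
    using exists_subset_between[of J k "{..<\<nu>}"] assms k_le by auto
  \<comment> \<open>\<open>g\<close> reads the indicator off an extracted row through any preimage;
    the choice is immaterial since the extraction fixes all entries in \<open>K\<close>, hence in
    \<open>J\<close>.\<close>
  define g :: "nat list \<Rightarrow> nat" where
    "g xs = (if \<exists>r. length r = \<nu> \<and> nths r K = xs \<and> (\<forall>j\<in>J. r ! j \<noteq> 0) then 1 else 0)" for xs
  have g: "g (nths r K) = (if \<forall>j\<in>J. r ! j \<noteq> 0 then 1 else 0)" if "length r = \<nu>" for r
  proof -
    have "\<forall>j\<in>J. r ! j \<noteq> 0"
      if "length r' = \<nu>" "nths r' K = nths r K" "\<forall>j\<in>J. r' ! j \<noteq> 0" for r'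
      using nths_eq_imp_nth_eq[of r' r K] that \<open>length r = \<nu>\<close> K by fastforce
    then show ?thesis
      using that unfolding g_def by auto
  qed
  have *: "(\<Sum>r\<leftarrow>A. if \<forall>j\<in>J. r ! j \<noteq> 0 then 1 else 0)
      = sum_mset (image_mset g (mset (extract_cols K A)))" if "array01 \<nu> A" for A
  proof -
    have "(\<Sum>r\<leftarrow>A. if \<forall>j\<in>J. r ! j \<noteq> 0 then 1 else 0) = (\<Sum>r\<leftarrow>A. g (nths r K))"
      using that by (intro arg_cong[where f = sum_list] map_cong refl)
        (auto simp: array01_def g)
    then show ?thesis
      by (simp add: extract_cols_def sum_mset_sum_list[symmetric] multiset.map_comp comp_def)
  qed
  show ?thesis
    using *[OF rows(1)] *[OF rows(2)] marginals[OF K(2,3)] by simp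
qed

text \<open>Exchange the sums over rows and over \<open>h\<close>-sets of columns, then compare the
  indicators set by set.\<close>

lemma sum_choose_weight_eq:
  assumes "h \<le> k"
  shows "(\<Sum>r\<leftarrow>N. weight r choose h) = (\<Sum>r\<leftarrow>D. weight r choose h)"
proof -
  let ?S = "{J. J \<subseteq> {..<\<nu>} \<and> card J = h}"
  have *: "(\<Sum>r\<leftarrow>A. weight r choose h)
      = (\<Sum>J\<in>?S. \<Sum>r\<leftarrow>A. if \<forall>j\<in>J. r ! j \<noteq> 0 then 1 else 0)" if "array01 \<nu> A" for A
    using that
  proof (induction A)
    case (Cons r A)
    then show ?case
      by (simp add: array01_def choose_weight sum.distrib)
  qed simp
  show ?thesis
    unfolding *[OF rows(1)] *[OF rows(2)]
    by (intro sum.cong refl sum_indicator_eq) (use assms in auto)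
qed

text \<open>By linearity: the Newton form only involves binomials \<open>s choose h\<close> with
  \<open>h \<le> k\<close>.\<close>

lemma sum_alt_poly_weight_eq:
  "(\<Sum>r\<leftarrow>N. alt_poly k (weight r)) = (\<Sum>r\<leftarrow>D. alt_poly k (weight r))"
proof -
  have *: "(\<Sum>r\<leftarrow>A. alt_poly k (weight r))
      = (\<Sum>h\<le>k. (-1) ^ (k + h) * 2 ^ h * int (\<Sum>r\<leftarrow>A. weight r choose h))" for A
    by (induction A) (simp_all add: alt_poly_def sum.distrib distrib_left)
  show ?thesis
    unfolding * by (intro sum.cong refl) (simp add: sum_choose_weight_eq)
qed

end

lemma weight_ones_row: "weight (ones_row \<nu>) = \<nu>"
proof -
  have "{j. j < \<nu> \<and> ones_row \<nu> ! j \<noteq> 0} = {..<\<nu>}"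
    by (auto simp: ones_row_def)
  then show ?thesis
    by (simp add: weight_def ones_row_def)
qed

text \<open>Each copy of \<open>a\<close> contributes \<open>f a\<close>, each other entry at least
  -1; collecting the copies gives the coefficient \<open>f a + 1\<close>.\<close>

lemma sum_list_ge_count:
  assumes "\<And>x. x \<in> set xs \<Longrightarrow> f x \<ge> (-1 :: int)"
  shows "(f a + 1) * int (count_list xs a) - int (length xs) \<le> (\<Sum>x\<leftarrow>xs. f x)"
  using assms by (induction xs) (force simp: algebra_simps)+

theorem theorem3:
  fixes \<nu> k :: nat and N D :: "nat list list"
  assumes "k \<ge> 1" and "\<nu> > k"
    and "(N, D) \<in> Delta \<nu> k k"
  shows "real (R_star \<nu> N D) / real (R_rows N D)
    \<le> 2 / (real (\<Sum>h=0..k. (\<nu> choose h) * ((\<nu> - 1 - h) choose (k - h))) + 1)"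
proof -
  have rows: "array01 \<nu> N" "array01 \<nu> D" and ones: "ones_row \<nu> \<in> set N"
    and small: "\<And>r. r \<in> set D \<Longrightarrow> card {j. j < \<nu> \<and> r ! j \<noteq> 0} \<le> k"
    and marg: "\<And>J. J \<subseteq> {..<\<nu>} \<Longrightarrow> card J = k \<Longrightarrow>
      mset (extract_cols J N) = mset (extract_cols J D)"
    using assms(3) by (auto simp: Delta_def)
  have "k \<le> \<nu>" using assms by simp
  note eqs = length_eq[OF this rows marg] sum_alt_poly_weight_eq[OF this rows marg]
  let ?B = "binomial_conv k \<nu>"
  have D: "alt_poly k (weight r) \<le> 1" if "r \<in> set D" for r
  proof -
    have "weight r \<le> k"
      using small[OF that] rows(2) that by (simp add: weight_def array01_def)
    then show ?thesis
      by (cases "even (k + weight r)") (simp_all add: alt_poly_le)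
  qed
  have "(int ?B + 1) * int (R_star \<nu> N D) - int (length N) \<le> (\<Sum>r\<leftarrow>N. alt_poly k (weight r))"
    using sum_list_ge_count[of N "\<lambda>r. alt_poly k (weight r)" "ones_row \<nu>"] alt_poly_ge assms(2)
    by (simp add: weight_ones_row alt_poly_gt R_star_def)
  also have "\<dots> = (\<Sum>r\<leftarrow>D. alt_poly k (weight r))"
    using eqs by simp
  also have "\<dots> \<le> (\<Sum>r\<leftarrow>D. 1)"
    by (rule sum_list_mono) (rule D)
  also have "\<dots> = int (length D)"
    by (simp add: sum_list_triv)
  finally have "(int ?B + 1) * int (R_star \<nu> N D) \<le> 2 * int (length D)"
    using eqs by simp
  then have "real_of_int ((int ?B + 1) * int (R_star \<nu> N D)) \<le> real_of_int (2 * int (length D))"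
    by (simp only: of_int_le_iff)
  then have main: "(real ?B + 1) * real (R_star \<nu> N D) \<le> 2 * real (length D)"
    by simp
  \<comment> \<open>\<open>N\<close> contains the all-ones row and \<open>D\<close> has equally many
    rows, so the ratio has a positive denominator.\<close>
  have pos: "real (length D) > 0"
    using ones eqs by (cases N) auto
  have "real (R_star \<nu> N D) / real (R_rows N D) \<le> 2 / (real ?B + 1)"
    using main pos by (simp add: R_rows_def divide_simps mult.commute)
  then show ?thesis
    by (simp only: binomial_conv_def atMost_atLeast0)
qed

end
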